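(* Let $\mathcal{A},\mathcal{E}\in\mathbb{C}^{I_{1}\times\cdots\times I_{N}\times J_{1}\times\cdots\times J_{N}}$ and $\mathcal{B}=\mathcal{A}+\mathcal{E}$. If $\mathrm{rank}_{U}(\mathcal{A})=r$ and $\mathrm{rank}_{U}(\mathcal{B})=s$, then $$\|\mathcal{B}^{\dagger}-\mathcal{A}^{\dagger}\|_{F}\leq\max\left\{\|\mathcal{A}^{\dagger}\|_{2}\|\mathcal{B}^{\dagger}\|_{2},\ \|\mathcal{A}^{\dagger}\|_{2}^{2},\ \|\mathcal{B}^{\dagger}\|_{2}^{2}\right\}\|\mathcal{E}\|_{F}.$$
   Context: Unfolding: $\phi$ is the bijection from $\mathbb{C}^{I_1\times\cdots\times I_M\times J_1\times\cdots\times J_N}$ to $\mathbb{C}^{(I_1\cdots I_M)\times(J_1\cdots J_N)}$ sending the entry of index $(i_1,\dots,i_M,j_1,\dots,j_N)$ to the matrix entry in row $i_1+\sum_{r=2}^{M}(i_r-1)\prod_{u=1}^{r-1}I_u$ and column $j_1+\sum_{s=2}^{N}(j_s-1)\prod_{v=1}^{s-1}J_v$. The unfolding rank is $\mathrm{rank}_U(\mathcal{A})=\mathrm{rank}(\phi(\mathcal{A}))$. The Frobenius norm is $\|\mathcal{A}\|_F=\big(\sum|a_{i_1\cdots i_Mj_1\cdots j_N}|^2\big)^{1/2}$ (sum over all indices), and the spectral norm $\|\mathcal{A}\|_2$ is the largest singular value of the matrix $\phi(\mathcal{A})$. Einstein product: for $\mathcal{A}\in\mathbb{C}^{I_1\times\cdots\times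 I_M\times J_1\times\cdots\times J_N}$ and $\mathcal{B}\in\mathbb{C}^{J_1\times\cdots\times J_N\times K_1\times\cdots\times K_L}$, $(\mathcal{A}*_N\mathcal{B})_{i_1\cdots i_Mk_1\cdots k_L}=\sum_{j_1,\dots,j_N}a_{i_1\cdots i_Mj_1\cdots j_N}b_{j_1\cdots j_Nk_1\cdots k_L}$. Conjugate transpose: $(\mathcal{A}^H)_{j_1\cdots j_Ni_1\cdots i_M}=\overline{a_{i_1\cdots i_Mj_1\cdots j_N}}$. Moore--Penrose inverse: for $\mathcal{X}\in\mathbb{C}^{I_1\times\cdots\times I_M\times J_1\times\cdots\times J_N}$, $\mathcal{X}^\dagger$ is the unique $\mathcal{Y}\in\mathbb{C}^{J_1\times\cdots\times J_N\times I_1\times\cdots\times I_M}$ with (1) $\mathcal{X}*_N\mathcal{Y}*_M\mathcal{X}=\mathcal{X}$, (2) $\mathcal{Y}*_M\mathcal{X}*_N\mathcal{Y}=\mathcal{Y}$, (3) $(\mathcal{X}*_N\mathcal{Y})^H=\mathcal{X}*_N\mathcal{Y}$, (4) $(\mathcal{Y}*_M\mathcal{X})^H=\mathcal{Y}*_M\mathcal{X}$. In the claim, $M=N$. *)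

theory Defs
  imports
    "HOL-Library.Function_Algebras"
    "Jordan_Normal_Form.Schur_Decomposition"
    "Jordan_Normal_Form.DL_Rank"
begin

text \<open>
  A tensor in the space of format I_1 x ... x I_M x J_1 x ... x J_N is a function of two
  multi-indices, \<open>A is js\<close>; the formats are the lists \<open>Is = [I_1, ..., I_M]\<close> and
  \<open>Js = [J_1, ..., J_N]\<close>. All indices start at 0 (as do those of \<^typ>\<open>complex mat\<close>). So that
  equality of tensors is equality of functions, the entries outside the format are 0.
\<close>

type_synonym tensor = "nat list \<Rightarrow> nat list \<Rightarrow> complex"

definition multi_indices :: "nat list \<Rightarrow> nat list set" where
  "multi_indices ds = {is. list_all2 (<) is ds}"

definition tensors :: "nat list \<Rightarrow> nat list \<Rightarrow> tensor set" where
  "tensors Is Js = {A. \<forall>i j. i \<notin> multi_indices Is \<or> j \<notin> multi_indices Js \<longrightarrow> A i j = 0}"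

definition einstein_prod :: "nat list \<Rightarrow> tensor \<Rightarrow> tensor \<Rightarrow> tensor" where
  "einstein_prod Js A B = (\<lambda>i k. \<Sum>j\<in>multi_indices Js. A i j * B j k)"

definition conj_transpose :: "tensor \<Rightarrow> tensor" where
  "conj_transpose A = (\<lambda>j i. cnj (A i j))"

definition is_MP_inverse :: "nat list \<Rightarrow> nat list \<Rightarrow> tensor \<Rightarrow> tensor \<Rightarrow> bool" where
  "is_MP_inverse Is Js X Y \<longleftrightarrow>
     Y \<in> tensors Js Is \<and>
     einstein_prod Is (einstein_prod Js X Y) X = X \<and>
     einstein_prod Js (einstein_prod Is Y X) Y = Y \<and>
     conj_transpose (einstein_prod Js X Y) = einstein_prod Js X Y \<and>
     conj_transpose (einstein_prod Is Y X) = einstein_prod Is Y X"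

definition MP_inverse :: "nat list \<Rightarrow> nat list \<Rightarrow> tensor \<Rightarrow> tensor" where
  "MP_inverse Is Js X = (THE Y. is_MP_inverse Is Js X Y)"

text \<open>
  With indices counted from 0, the position
  i_1 + sum_{r=2..M} (i_r - 1) prod_{u=1..r-1} I_u (counted from 1) becomes the following sum,
  whose term for \<open>r = 0\<close> is the first index.
\<close>

definition linear_index :: "nat list \<Rightarrow> nat list \<Rightarrow> nat" where
  "linear_index ds is = (\<Sum>r<length ds. is ! r * (\<Prod>u<r. ds ! u))"

definition unfold_tensor :: "nat list \<Rightarrow> nat list \<Rightarrow> tensor \<Rightarrow> complex mat" where
  "unfold_tensor Is Js A =
     mat (prod_list Is) (prod_list Js)
       (\<lambda>(p, q). A (the_inv_into (multi_indices Is) (linear_index Is) p)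
                   (the_inv_into (multi_indices Js) (linear_index Js) q))"

definition unfolding_rank :: "nat list \<Rightarrow> nat list \<Rightarrow> tensor \<Rightarrow> nat" where
  "unfolding_rank Is Js A = vec_space.rank (prod_list Is) (unfold_tensor Is Js A)"

definition frobenius_norm :: "nat list \<Rightarrow> nat list \<Rightarrow> tensor \<Rightarrow> real" where
  "frobenius_norm Is Js A =
     sqrt (\<Sum>i\<in>multi_indices Is. \<Sum>j\<in>multi_indices Js. (cmod (A i j))\<^sup>2)"

text \<open>
  The singular values are the nonnegative square roots of the eigenvalues of the Gram matrix.
  For a matrix with more columns than rows this set contains 0 even if the
  matrix has full rank, which does not affect its maximum.
\<close>

definition singular_values :: "complex mat \<Rightarrow> real set" where
  "singular_values Z =
     {\<sigma>. 0 \<le> \<sigma> \<and> eigenvalue (mat_adjoint Z * Z) (complex_of_real (\<sigma>\<^sup>2))}"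

definition spectral_norm :: "nat list \<Rightarrow> nat list \<Rightarrow> tensor \<Rightarrow> real" where
  "spectral_norm Is Js A = Max (singular_values (unfold_tensor Is Js A))"

lemma multi_indices_Cons:
  "multi_indices (d # ds) = {i # is |i is. i < d \<and> is \<in> multi_indices ds}"
  by (auto simp: multi_indices_def list_all2_Cons2)

lemma linear_index_Cons:
  "linear_index (d # ds) (i # is) = i + d * linear_index ds is"
  unfolding linear_index_def
  by (simp add: sum.lessThan_Suc_shift prod.lessThan_Suc_shift sum_distrib_left ac_simps
      del: sum.lessThan_Suc prod.lessThan_Suc)

lemma linear_index_bij:
  "bij_betw (linear_index ds) (multi_indices ds) {..<prod_list ds}"
proof (induction ds)
  case Nil
  then show ?case
    by (auto simp: multi_indices_def linear_index_def bij_betw_def)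
next
  case (Cons d ds)
  let ?f = "linear_index ds" and ?S = "multi_indices ds"
  have inj: "inj_on ?f ?S" and im: "?f ` ?S = {..<prod_list ds}"
    using Cons.IH by (auto simp: bij_betw_def)
  show ?case
    unfolding bij_betw_def
  proof
    show "inj_on (linear_index (d # ds)) (multi_indices (d # ds))"
    proof (rule inj_onI)
      fix x y
      assume "x \<in> multi_indices (d # ds)" "y \<in> multi_indices (d # ds)"
        and eq: "linear_index (d # ds) x = linear_index (d # ds) y"
      then obtain i "is" j js where x: "x = i # is" "i < d" "is \<in> ?S"
        and y: "y = j # js" "j < d" "js \<in> ?S"
        by (auto simp: multi_indices_Cons)
      have e: "i + d * ?f is = j + d * ?f js"
        using eq x y by (simp add: linear_index_Cons)
      have "i = (i + d * ?f is) mod d" "j = (j + d * ?f js) mod d"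
        using x y by auto
      then have "i = j" using e by simp
      moreover have "?f is = ?f js" using e \<open>i = j\<close> x by simp
      ultimately show "x = y" using inj x y by (auto dest: inj_onD)
    qed
    show "linear_index (d # ds) ` multi_indices (d # ds) = {..<prod_list (d # ds)}"
    proof (intro subset_antisym subsetI)
      fix p assume "p \<in> linear_index (d # ds) ` multi_indices (d # ds)"
      then obtain i "is" where p: "p = i + d * ?f is" "i < d" "is \<in> ?S"
        by (auto simp: multi_indices_Cons linear_index_Cons)
      then have "Suc (?f is) \<le> prod_list ds" using im by (auto simp: Suc_le_eq)
      then have "d * Suc (?f is) \<le> d * prod_list ds" by (rule mult_le_mono2)
      then show "p \<in> {..<prod_list (d # ds)}" using p by simp
    next
      fix p assume "p \<in> {..<prod_list (d # ds)}"
      then have p: "p < d * prod_list ds" by simp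
      then have d: "0 < d" by (cases d) auto
      have "p div d \<in> {..<prod_list ds}" using p by (simp add: less_mult_imp_div_less mult.commute)
      then obtain "is" where "is \<in> ?S" "?f is = p div d" using im by (metis imageE)
      then have "p mod d # is \<in> multi_indices (d # ds)" "linear_index (d # ds) (p mod d # is) = p"
        using d by (auto simp: multi_indices_Cons linear_index_Cons)
      then show "p \<in> linear_index (d # ds) ` multi_indices (d # ds)" by (metis imageI)
    qed
  qed
qed

lemma unfold_tensor_entry:
  assumes "i \<in> multi_indices Is" "j \<in> multi_indices Js"
  shows "unfold_tensor Is Js A $$ (linear_index Is i, linear_index Js j) = A i j"
proof -
  have "linear_index Is i < prod_list Is" "linear_index Js j < prod_list Js"
    using assms linear_index_bij by (auto simp: bij_betw_def)
  then show ?thesis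
    using assms linear_index_bij
    by (simp add: unfold_tensor_def the_inv_into_f_f bij_betw_def)
qed

end

theory Submission
  imports Defs "Jordan_Normal_Form.Spectral_Radius" "HOL-Analysis.L2_Norm"
begin

text \<open>
  Write \<open>X = A\<^sup>\<dagger>\<close>, \<open>Y = B\<^sup>\<dagger>\<close> and let \<open>P = BY\<close>, \<open>Q = YB\<close>, \<open>R = AX\<close>, \<open>S = XA\<close> be the associated orthogonal
  projections. Wedin's decomposition
  \<open>Y - X = (YR - QX) + (Y - YR) + (QX - X)\<close> has pairwise orthogonal summands, equal to
  \<open>- Y (PES) X\<close>, \<open>Y Y\<^sup>H ((1 - R)EQ)\<^sup>H\<close> and \<open>(RE(1 - Q))\<^sup>H X\<^sup>H X\<close>. With \<open>c\<close> the maximum in the claim, their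
  norms are at most \<open>c\<close> times those of \<open>PES\<close>, \<open>(1 - R)EQ\<close> and \<open>RE(1 - Q)\<close>. The last two blocks are
  orthogonal to \<open>REQ\<close> and to each other in \<open>E\<close>, so
  \<open>\<parallel>Y - X\<parallel>\<^sup>2 \<le> c\<^sup>2 (\<parallel>E\<parallel>\<^sup>2 + \<parallel>PES\<parallel>\<^sup>2 - \<parallel>REQ\<parallel>\<^sup>2)\<close>.
  Exchanging \<open>A\<close> and \<open>B\<close> exchanges \<open>PES\<close> and \<open>REQ\<close> (up to sign); adding the two
  inequalities cancels both terms.
\<close>

section \<open>Diagonalization of Hermitian matrices\<close>

lemma dim_mat_adjoint [simp]:
  "dim_row (mat_adjoint A) = dim_col A" "dim_col (mat_adjoint A) = dim_row A"
  by (simp_all add: mat_adjoint_def)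

lemma mat_adjoint_carrier [simp]:
  "A \<in> carrier_mat m n \<Longrightarrow> mat_adjoint A \<in> carrier_mat n m"
  by (metis carrier_matD carrier_matI dim_mat_adjoint)

lemma mat_adjoint_index [simp]:
  "i < dim_col A \<Longrightarrow> j < dim_row A \<Longrightarrow> mat_adjoint A $$ (i, j) = conjugate (A $$ (j, i))"
  by (simp add: mat_adjoint_def mat_of_rows_index)

lemma mult_mat_index_sum:
  assumes "A \<in> carrier_mat m n" "B \<in> carrier_mat n k" "i < m" "j < k"
  shows "(A * B) $$ (i, j) = (\<Sum>l<n. A $$ (i, l) * B $$ (l, j))"
  using assms by (auto simp: scalar_prod_def atLeast0LessThan)

lemma mat_adjoint_mult:
  fixes A B :: "complex mat"
  assumes "A \<in> carrier_mat m n" "B \<in> carrier_mat n k"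
  shows "mat_adjoint (A * B) = mat_adjoint B * mat_adjoint A"
proof (rule eq_matI)
  fix i j assume "i < dim_row (mat_adjoint B * mat_adjoint A)" "j < dim_col (mat_adjoint B * mat_adjoint A)"
  then have ij: "i < k" "j < m" using assms by auto
  have "mat_adjoint (A * B) $$ (i, j) = (\<Sum>l<n. cnj (A $$ (j, l)) * cnj (B $$ (l, i)))"
    using ij assms mult_mat_index_sum[OF assms ij(2,1)] by simp
  also have "\<dots> = (mat_adjoint B * mat_adjoint A) $$ (i, j)"
    using ij assms by (subst mult_mat_index_sum[of _ k n _ m]) (auto intro!: sum.cong)
  finally show "mat_adjoint (A * B) $$ (i, j) = (mat_adjoint B * mat_adjoint A) $$ (i, j)" .
qed (use assms in auto)

lemma mat_adjoint_adjoint [simp]: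
  fixes A :: "complex mat"
  shows "mat_adjoint (mat_adjoint A) = A"
  by (rule eq_matI) auto

definition real_diag_mat :: "nat \<Rightarrow> (nat \<Rightarrow> real) \<Rightarrow> complex mat" where
  "real_diag_mat n d = mat n n (\<lambda>(i, j). if i = j then complex_of_real (d i) else 0)"

lemma real_diag_mat_carrier [simp]: "real_diag_mat n d \<in> carrier_mat n n"
  by (simp add: real_diag_mat_def)

text \<open>Gram-Schmidt on a basis that begins with \<open>v\<close> keeps \<open>v\<close> in
  front. The resulting vectors are orthogonal but not of unit length, so the columns of
  \<open>W\<close> are divided by their norms; hence the scalar \<open>c\<close>.\<close>

lemma unitary_completion:
  fixes v :: "complex vec"
  assumes v: "v \<in> carrier_vec n" and v0: "v \<noteq> 0\<^sub>v n"
  obtains W c where "W \<in> carrier_mat n n" "mat_adjoint W * W = 1\<^sub>m n" "W * mat_adjoint W = 1\<^sub>m n"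
    "col W 0 = c \<cdot>\<^sub>v v"
proof -
  interpret cof_vec_space n "TYPE(complex)" .
  note b = basis_completion[OF v v0]
  define ws where "ws = gram_schmidt n (basis_completion v)"
  from gram_schmidt_result[OF b(2,4,5) refl] b(6)
  have ws: "set ws \<subseteq> carrier_vec n" "corthogonal ws" "length ws = n"
    by (auto simp: ws_def)
  have n: "0 < n" using v v0 by (cases n) auto
  obtain vs where bv: "basis_completion v = v # vs" 
    using n b(6,7) by (cases "basis_completion v") auto
  have hd: "ws ! 0 = v"
    using gram_schmidt_hd[OF v, of vs] n ws(3) by (cases ws) (auto simp: ws_def bv)
  define nrm where "nrm j = sqrt (\<Sum>k<n. (cmod (ws ! j $ k))\<^sup>2)" for j
  define W where "W = mat n n (\<lambda>(i, j). ws ! j $ i / complex_of_real (nrm j))"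
  have W: "W \<in> carrier_mat n n" by (simp add: W_def)
  have wsd: "dim_vec (ws ! j) = n" if "j < n" for j
    using ws that by (metis carrier_vecD nth_mem subsetD)
  have inner: "(\<Sum>k<n. cnj (ws ! i $ k) * ws ! j $ k) = (if i = j then complex_of_real ((nrm i)\<^sup>2) else 0)"
    if "i < n" "j < n" for i j
  proof (cases "i = j")
    case True
    have "(nrm i)\<^sup>2 = (\<Sum>k<n. (cmod (ws ! i $ k))\<^sup>2)"
      by (simp add: nrm_def sum_nonneg)
    then show ?thesis using True
      by (simp add: complex_norm_square mult.commute del: of_real_power)
  next
    case False
    have "ws ! j \<bullet>c ws ! i = 0" using corthogonalD[OF ws(2)] that False ws(3) by simp
    then show ?thesis using False wsd[OF that(1)] wsd[OF that(2)]
      by (simp add: scalar_prod_def atLeast0LessThan mult.commute)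
  qed
  \<comment> \<open>\<open>corthogonal\<close> also excludes vectors whose product with themselves
    is 0, so the division in \<open>W\<close> is legitimate.\<close>
  have nrm0: "nrm j \<noteq> 0" if "j < n" for j
  proof
    assume "nrm j = 0"
    then have "ws ! j \<bullet>c ws ! j = 0" using inner[OF that that] wsd[OF that] 
      by (simp add: scalar_prod_def atLeast0LessThan mult.commute)
    then show False using corthogonalD[OF ws(2)] that ws(3) by blast
  qed
  have WW: "mat_adjoint W * W = 1\<^sub>m n"
  proof (rule eq_matI)
    fix i j assume "i < dim_row (1\<^sub>m n :: complex mat)" "j < dim_col (1\<^sub>m n :: complex mat)"
    then have ij: "i < n" "j < n" by auto
    have "(mat_adjoint W * W) $$ (i, j)
        = (\<Sum>k<n. (cnj (ws ! i $ k) * ws ! j $ k) / (of_real (nrm i) * of_real (nrm j)))"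
      using ij W by (subst mult_mat_index_sum[of _ n n _ n]) (auto intro!: sum.cong simp: W_def)
    also have "\<dots> = 1\<^sub>m n $$ (i, j)"
      using ij nrm0 by (simp add: sum_divide_distrib[symmetric] inner power2_eq_square)
    finally show "(mat_adjoint W * W) $$ (i, j) = 1\<^sub>m n $$ (i, j)" .
  qed (use W in auto)
  have "W * mat_adjoint W = 1\<^sub>m n"
    by (rule mat_mult_left_right_inverse[OF _ W WW]) (use W in auto)
  moreover have "col W 0 = (1 / complex_of_real (nrm 0)) \<cdot>\<^sub>v v"
    using n v hd by (intro eq_vecI) (auto simp: W_def)
  ultimately show thesis using that W WW by blast
qed

text \<open>Induction by deflation: in a unitary basis that starts with an eigenvector, a Hermitian
  matrix splits into a 1 x 1 block and a smaller Hermitian block, to which the induction hypothesis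
  applies.\<close>

theorem hermitian_diagonalization:
  fixes A :: "complex mat"
  assumes "A \<in> carrier_mat n n" "mat_adjoint A = A"
  shows "\<exists>U d. U \<in> carrier_mat n n \<and> mat_adjoint U * U = 1\<^sub>m n \<and> U * mat_adjoint U = 1\<^sub>m n
    \<and> A = U * real_diag_mat n d * mat_adjoint U"
  using assms
proof (induction n arbitrary: A)
  case 0
  then show ?case
    by (intro exI[of _ "1\<^sub>m 0"] exI[of _ "\<lambda>_. 0"]) (auto intro!: eq_matI)
next
  case (Suc n A)
  let ?n = "Suc n"
  note A = Suc.prems(1)
  obtain e where "eigenvalue A e" using spectrum_non_empty[OF A] by (auto simp: spectrum_def)
  then obtain v where v: "v \<in> carrier_vec ?n" "v \<noteq> 0\<^sub>v ?n" and ev: "A *\<^sub>v v = e \<cdot>\<^sub>v v"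
    using A by (auto simp: eigenvalue_def eigenvector_def)
  obtain W c where W: "W \<in> carrier_mat ?n ?n" and WW: "mat_adjoint W * W = 1\<^sub>m ?n"
    "W * mat_adjoint W = 1\<^sub>m ?n" and W0: "col W 0 = c \<cdot>\<^sub>v v"
    using unitary_completion[OF v] .
  let ?H = "mat_adjoint W"
  have H: "?H \<in> carrier_mat ?n ?n" using W by simp
  define A' where "A' = ?H * (A * W)"
  have A': "A' \<in> carrier_mat ?n ?n"
    using A W H unfolding A'_def by (intro mult_carrier_mat[of _ ?n ?n])
  have herm: "mat_adjoint A' = A'"
    unfolding A'_def using A W H
    by (simp add: mat_adjoint_mult[of _ ?n ?n _ ?n] Suc.prems(2) assoc_mult_mat[of _ ?n ?n _ ?n _ ?n])
  have cnjA': "A' $$ (i, j) = cnj (A' $$ (j, i))" if "i < ?n" "j < ?n" for i j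
    using mat_adjoint_index[of i A' j] that A' herm by simp
  have AW: "A *\<^sub>v col W 0 = e \<cdot>\<^sub>v col W 0"
    unfolding W0 using v A ev by (auto simp: mult_mat_vec smult_smult_assoc mult.commute)
  \<comment> \<open>Column 0 of \<open>W\<^sup>H A W\<close> is \<open>W\<^sup>H\<close> applied to
    \<open>e\<close> times column 0 of \<open>W\<close>, hence \<open>e\<close> times column 0 of
    the identity. The zeros in row 0 then follow by Hermitian symmetry.\<close>
  have col0: "A' $$ (i, 0) = (if i = 0 then e else 0)" if "i < ?n" for i
  proof -
    have "A' $$ (i, 0) = row ?H i \<bullet> col (A * W) 0"
      unfolding A'_def using that A W H by (subst index_mult_mat) auto
    also have "col (A * W) 0 = e \<cdot>\<^sub>v col W 0"
      by (simp only: col_mult2[OF A W zero_less_Suc] AW)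
    also have "row ?H i \<bullet> (e \<cdot>\<^sub>v col W 0) = e * (row ?H i \<bullet> col W 0)"
      by (rule scalar_prod_smult_distrib[OF row_carrier_vec[OF that H]
            col_carrier_vec[OF zero_less_Suc W]])
    also have "row ?H i \<bullet> col W 0 = (?H * W) $$ (i, 0)"
      using that H W by (subst index_mult_mat) simp_all
    also have "\<dots> = (if i = 0 then 1 else 0)" unfolding WW using that by simp
    finally show ?thesis by simp
  qed
  have row0: "A' $$ (0, i) = (if i = 0 then e else 0)" if "i < ?n" for i
    using cnjA'[of 0 i] col0[of i] col0[of 0] that by (metis complex_cnj_zero zero_less_Suc)
  \<comment> \<open>The eigenvalue is a diagonal entry of the Hermitian matrix \<open>A'\<close>,
    hence real.\<close>
  have "e = cnj e" using cnjA'[of 0 0] col0[of 0] by simp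
  then have e: "complex_of_real (Re e) = e" by (simp add: complex_eq_iff)
  define A3 where "A3 = mat n n (\<lambda>(i, j). A' $$ (Suc i, Suc j))"
  have A3: "A3 \<in> carrier_mat n n" by (simp add: A3_def)
  have "mat_adjoint A3 = A3"
    using A3 by (intro eq_matI) (simp_all add: A3_def cnjA'[symmetric])
  then obtain U3 d3 where U3: "U3 \<in> carrier_mat n n"
    and UU3: "mat_adjoint U3 * U3 = 1\<^sub>m n" "U3 * mat_adjoint U3 = 1\<^sub>m n"
    and A3eq: "A3 = U3 * real_diag_mat n d3 * mat_adjoint U3"
    using Suc.IH[OF A3] by metis
  let ?F = "\<lambda>X Y. four_block_mat X (0\<^sub>m 1 n) (0\<^sub>m n 1) Y"
  \<comment> \<open>The eigenvalue split off goes in front of those of the block \<open>A3\<close>;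
    accordingly \<open>V\<close> borders \<open>U3\<close> with a 1.\<close>
  define d where "d = (\<lambda>k. case k of 0 \<Rightarrow> Re e | Suc k \<Rightarrow> d3 k)"
  define V where "V = ?F (1\<^sub>m 1) U3"
  have V: "V \<in> carrier_mat ?n ?n" 
    using four_block_carrier_mat[OF one_carrier_mat[of 1] U3] by (simp add: V_def)
  have VH: "mat_adjoint V = ?F (1\<^sub>m 1) (mat_adjoint U3)"
    using carrier_matD[OF U3] by (intro eq_matI) (auto simp: V_def)
  have D: "real_diag_mat ?n d = ?F (mat 1 1 (\<lambda>_. e)) (real_diag_mat n d3)"
    by (intro eq_matI) (auto simp: real_diag_mat_def d_def e split: nat.split)
  have A'eq: "A' = ?F (mat 1 1 (\<lambda>_. e)) A3"
    using carrier_matD[OF A'] by (intro eq_matI) (auto simp: A3_def col0 row0)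
  have mF: "?F X Y * ?F X' Y' = ?F (X * X') (Y * Y')"
    if "X \<in> carrier_mat 1 1" "X' \<in> carrier_mat 1 1" "Y \<in> carrier_mat n n" "Y' \<in> carrier_mat n n"
    for X X' Y Y' :: "complex mat"
    using that by (subst mult_four_block_mat[of _ 1 1 _ n _ n _ _ 1 _ n]) auto
  have VV: "mat_adjoint V * V = 1\<^sub>m ?n" "V * mat_adjoint V = 1\<^sub>m ?n"
    unfolding VH unfolding V_def 
    using U3 UU3 by (simp_all add: mF plus_1_eq_Suc del: One_nat_def)
  have A'V: "A' = V * real_diag_mat ?n d * mat_adjoint V"
  proof -
    have "V * real_diag_mat ?n d = ?F (mat 1 1 (\<lambda>_. e)) (U3 * real_diag_mat n d3)"
      unfolding V_def D by (subst mF[OF _ _ U3]) (simp_all del: One_nat_def)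
    moreover have "?F (mat 1 1 (\<lambda>_. e)) (U3 * real_diag_mat n d3) * mat_adjoint V
        = ?F (mat 1 1 (\<lambda>_. e)) A3"
      unfolding VH A3eq
      by (subst mF[OF _ _ mult_carrier_mat[OF U3 real_diag_mat_carrier] mat_adjoint_carrier[OF U3]])
        (simp_all del: One_nat_def)
    ultimately show ?thesis by (simp only: A'eq)
  qed
  define U where "U = W * V"
  have U: "U \<in> carrier_mat ?n ?n" using W V unfolding U_def by (intro mult_carrier_mat[of _ ?n ?n])
  have VH': "mat_adjoint V \<in> carrier_mat ?n ?n" using V by simp
  have UH: "mat_adjoint U = mat_adjoint V * ?H" using W V by (simp add: U_def mat_adjoint_mult)
  note assoc = assoc_mult_mat[of _ ?n ?n _ ?n _ ?n] mult_carrier_mat[of _ ?n ?n _ ?n]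
  have "mat_adjoint U * U = mat_adjoint V * ((?H * W) * V)"
    unfolding UH unfolding U_def using W V H VH' by (simp add: assoc)
  then have U1: "mat_adjoint U * U = 1\<^sub>m ?n" using WW VV V by simp
  have U2: "U * mat_adjoint U = 1\<^sub>m ?n"
    by (rule mat_mult_left_right_inverse[OF _ U U1]) (use U in auto)
  have "A = (W * ?H) * (A * (W * ?H))" using A WW by simp
  also have "\<dots> = W * A' * ?H" unfolding A'_def using A W H by (simp add: assoc)
  also have "\<dots> = U * real_diag_mat ?n d * mat_adjoint U"
    unfolding A'V UH unfolding U_def using W V H VH' by (simp add: assoc)
  finally show ?case using U U1 U2 by (intro exI conjI)
qed

text \<open>Similar matrices share their characteristic polynomial, and that of the diagonal matrix
  is the product of its linear factors, which vanishes at each diagonal entry.\<close>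

lemma eigenvalue_unitary_diag:
  fixes U :: "complex mat"
  assumes U: "U \<in> carrier_mat n n" and UU: "mat_adjoint U * U = 1\<^sub>m n" "U * mat_adjoint U = 1\<^sub>m n"
    and k: "k < n"
  shows "eigenvalue (U * real_diag_mat n d * mat_adjoint U) (complex_of_real (d k))"
proof -
  let ?D = "real_diag_mat n d" and ?A = "U * real_diag_mat n d * mat_adjoint U"
  have A: "?A \<in> carrier_mat n n" using U by (intro mult_carrier_mat[of _ n n]) auto
  have "similar_mat ?A ?D"
    unfolding similar_mat_def
    by (intro exI, rule similar_mat_witI[OF UU(2,1) refl A]) (use U in auto)
  then have "char_poly ?A = char_poly ?D" by (rule char_poly_similar)
  also have "\<dots> = (\<Prod>a\<leftarrow>diag_mat ?D. [:- a, 1:])"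
    by (rule char_poly_upper_triangular[of _ n]) (auto simp: real_diag_mat_def)
  finally have "poly (char_poly ?A) (of_real (d k)) = (\<Prod>a\<leftarrow>diag_mat ?D. of_real (d k) - a)"
    by (simp add: poly_prod_list o_def)
  moreover have "complex_of_real (d k) \<in> set (diag_mat ?D)"
    using k by (auto simp: diag_mat_def real_diag_mat_def intro!: image_eqI[of _ _ k])
  then have "(\<Prod>a\<leftarrow>diag_mat ?D. complex_of_real (d k) - a) = 0"
    by (simp add: prod_list_zero_iff)
  ultimately show ?thesis by (simp add: eigenvalue_root_char_poly[OF A])
qed

section \<open>The Einstein product and the Frobenius inner product\<close>

abbreviation einstein_infix ("(_ \<cdot>\<^bsub>_\<^esub>/ _)" [71, 0, 70] 70) where
  "A \<cdot>\<^bsub>Js\<^esub> B \<equiv> einstein_prod Js A B"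

lemma finite_multi_indices [simp]: "finite (multi_indices ds)"
  using bij_betw_finite[OF linear_index_bij] by blast

lemma einstein_assoc:
  "(A \<cdot>\<^bsub>Js\<^esub> B) \<cdot>\<^bsub>Ks\<^esub> C = A \<cdot>\<^bsub>Js\<^esub> (B \<cdot>\<^bsub>Ks\<^esub> C)"
proof (intro ext)
  fix i l
  have "((A \<cdot>\<^bsub>Js\<^esub> B) \<cdot>\<^bsub>Ks\<^esub> C) i l
      = (\<Sum>k\<in>multi_indices Ks. \<Sum>j\<in>multi_indices Js. A i j * (B j k * C k l))"
    by (simp add: einstein_prod_def sum_distrib_right mult.assoc)
  also have "\<dots> = (A \<cdot>\<^bsub>Js\<^esub> (B \<cdot>\<^bsub>Ks\<^esub> C)) i l"
    by (subst sum.swap) (simp add: einstein_prod_def sum_distrib_left)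
  finally show "((A \<cdot>\<^bsub>Js\<^esub> B) \<cdot>\<^bsub>Ks\<^esub> C) i l = (A \<cdot>\<^bsub>Js\<^esub> (B \<cdot>\<^bsub>Ks\<^esub> C)) i l" .
qed

lemma einstein_diff_left: "(A - B) \<cdot>\<^bsub>Js\<^esub> C = A \<cdot>\<^bsub>Js\<^esub> C - B \<cdot>\<^bsub>Js\<^esub> C"
  by (intro ext) (simp add: einstein_prod_def sum_subtractf left_diff_distrib)

lemma einstein_diff_right: "A \<cdot>\<^bsub>Js\<^esub> (B - C) = A \<cdot>\<^bsub>Js\<^esub> B - A \<cdot>\<^bsub>Js\<^esub> C"
  by (intro ext) (simp add: einstein_prod_def sum_subtractf right_diff_distrib)

lemma einstein_uminus:
  "(- A) \<cdot>\<^bsub>Js\<^esub> B = - (A \<cdot>\<^bsub>Js\<^esub> B)" "A \<cdot>\<^bsub>Js\<^esub> (- B) = - (A \<cdot>\<^bsub>Js\<^esub> B)"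
  by (intro ext, simp add: einstein_prod_def sum_negf)+

lemma conj_transpose_einstein:
  "conj_transpose (A \<cdot>\<^bsub>Js\<^esub> B) = conj_transpose B \<cdot>\<^bsub>Js\<^esub> conj_transpose A"
  by (intro ext) (simp add: einstein_prod_def conj_transpose_def mult.commute)

lemma conj_transpose_diff: "conj_transpose (A - B) = conj_transpose A - conj_transpose B"
  by (intro ext) (simp add: conj_transpose_def)

lemma conj_transpose_conj_transpose [simp]: "conj_transpose (conj_transpose A) = A"
  by (simp add: conj_transpose_def)

lemma einstein_tensors:
  "A \<in> tensors Is Js \<Longrightarrow> B \<in> tensors Js Ks \<Longrightarrow> A \<cdot>\<^bsub>Js\<^esub> B \<in> tensors Is Ks"
  by (auto simp: tensors_def einstein_prod_def)

lemma conj_transpose_tensors: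
  "A \<in> tensors Is Js \<Longrightarrow> conj_transpose A \<in> tensors Js Is"
  by (auto simp: tensors_def conj_transpose_def)

text \<open>This is the trace of \<open>X\<^sup>H Y\<close>, the inner product behind the Frobenius
  norm; orthogonality of tensors refers to it.\<close>

definition frob_inner :: "nat list \<Rightarrow> nat list \<Rightarrow> tensor \<Rightarrow> tensor \<Rightarrow> complex" where
  "frob_inner Is Js X Y = (\<Sum>i\<in>multi_indices Is. \<Sum>j\<in>multi_indices Js. cnj (X i j) * Y i j)"

lemma frobenius_norm_nonneg [simp]: "0 \<le> frobenius_norm Is Js X"
  by (simp add: frobenius_norm_def sum_nonneg)

lemma frobenius_norm_sq:
  "(frobenius_norm Is Js X)\<^sup>2 = (\<Sum>i\<in>multi_indices Is. \<Sum>j\<in>multi_indices Js. (cmod (X i j))\<^sup>2)"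
  by (simp add: frobenius_norm_def sum_nonneg)

lemma frob_inner_self: "frob_inner Is Js X X = complex_of_real ((frobenius_norm Is Js X)\<^sup>2)"
  unfolding frobenius_norm_sq frob_inner_def of_real_sum complex_norm_square
  by (simp add: mult.commute)

lemma frob_inner_commute: "frob_inner Is Js X Y = cnj (frob_inner Is Js Y X)"
  by (simp add: frob_inner_def mult.commute)

lemma frob_inner_zero [simp]: "frob_inner Is Js X 0 = 0"
  by (simp add: frob_inner_def)

lemma frob_inner_diff_left:
  "frob_inner Is Js (X - Y) Z = frob_inner Is Js X Z - frob_inner Is Js Y Z"
  by (simp add: frob_inner_def sum_subtractf left_diff_distrib)

lemma frob_inner_diff_right:
  "frob_inner Is Js Z (X - Y) = frob_inner Is Js Z X - frob_inner Is Js Z Y"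
  by (simp add: frob_inner_def sum_subtractf right_diff_distrib)

text \<open>Both sides are the same triple sum; three interchanges carry the index \<open>i\<close>
  of the outermost sum to the innermost place.\<close>

lemma frob_inner_adjoint_left:
  "frob_inner Is Ks (K \<cdot>\<^bsub>Js\<^esub> X) Y = frob_inner Js Ks X (conj_transpose K \<cdot>\<^bsub>Is\<^esub> Y)"
proof -
  let ?f = "\<lambda>i j k. cnj (X j k) * (cnj (K i j) * Y i k)"
  have "frob_inner Is Ks (K \<cdot>\<^bsub>Js\<^esub> X) Y
      = (\<Sum>i\<in>multi_indices Is. \<Sum>k\<in>multi_indices Ks. \<Sum>j\<in>multi_indices Js. ?f i j k)"
    by (simp add: frob_inner_def einstein_prod_def sum_distrib_left sum_distrib_right mult_ac)
  also have "\<dots> = (\<Sum>i\<in>multi_indices Is. \<Sum>j\<in>multi_indices Js. \<Sum>k\<in>multi_indices Ks. ?f i j k)"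
    by (intro sum.cong refl sum.swap)
  also have "\<dots> = (\<Sum>j\<in>multi_indices Js. \<Sum>i\<in>multi_indices Is. \<Sum>k\<in>multi_indices Ks. ?f i j k)"
    by (rule sum.swap)
  also have "\<dots> = (\<Sum>j\<in>multi_indices Js. \<Sum>k\<in>multi_indices Ks. \<Sum>i\<in>multi_indices Is. ?f i j k)"
    by (intro sum.cong refl sum.swap)
  also have "\<dots> = frob_inner Js Ks X (conj_transpose K \<cdot>\<^bsub>Is\<^esub> Y)"
    by (simp add: frob_inner_def einstein_prod_def conj_transpose_def sum_distrib_left)
  finally show ?thesis .
qed

lemma frob_inner_conj_transpose:
  "frob_inner Js Is (conj_transpose X) (conj_transpose Y) = frob_inner Is Js Y X"
  unfolding frob_inner_def by (subst sum.swap) (simp add: conj_transpose_def mult.commute)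

text \<open>Conjugate transposition turns right factors into left factors and exchanges the two
  arguments, which reduces this to the case of a left factor.\<close>

lemma frob_inner_adjoint_right:
  "frob_inner Is Ks (X \<cdot>\<^bsub>Js\<^esub> K) Y = frob_inner Is Js X (Y \<cdot>\<^bsub>Ks\<^esub> conj_transpose K)"
proof -
  have "frob_inner Is Ks (X \<cdot>\<^bsub>Js\<^esub> K) Y = cnj (frob_inner Is Ks Y (X \<cdot>\<^bsub>Js\<^esub> K))"
    by (rule frob_inner_commute)
  also have "frob_inner Is Ks Y (X \<cdot>\<^bsub>Js\<^esub> K)
      = frob_inner Ks Is (conj_transpose K \<cdot>\<^bsub>Js\<^esub> conj_transpose X) (conj_transpose Y)"
    by (simp only: frob_inner_conj_transpose flip: conj_transpose_einstein)
  also have "\<dots> = frob_inner Js Is (conj_transpose X) (conj_transpose (Y \<cdot>\<^bsub>Ks\<^esub> conj_transpose K))"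
    by (simp add: frob_inner_adjoint_left conj_transpose_einstein)
  also have "cnj \<dots> = frob_inner Is Js X (Y \<cdot>\<^bsub>Ks\<^esub> conj_transpose K)"
    unfolding frob_inner_conj_transpose by (rule frob_inner_commute[symmetric])
  finally show ?thesis .
qed

lemma frobenius_norm_conj_transpose [simp]:
  "frobenius_norm Js Is (conj_transpose X) = frobenius_norm Is Js X"
  unfolding frobenius_norm_def by (subst sum.swap) (simp add: conj_transpose_def)

lemma frobenius_norm_uminus [simp]: "frobenius_norm Is Js (- X) = frobenius_norm Is Js X"
  by (simp add: frobenius_norm_def)

text \<open>Pythagoras: the two cross terms are conjugates of each other, so both vanish.\<close>

lemma frobenius_norm_diff_orthogonal:
  assumes "frob_inner Is Js X Y = 0"
  shows "(frobenius_norm Is Js (X - Y))\<^sup>2 = (frobenius_norm Is Js X)\<^sup>2 + (frobenius_norm Is Js Y)\<^sup>2"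
proof -
  have "frob_inner Is Js Y X = 0" using assms frob_inner_commute[of Is Js Y X] by simp
  then have "frob_inner Is Js (X - Y) (X - Y) = frob_inner Is Js X X + frob_inner Is Js Y Y"
    using assms by (simp add: frob_inner_diff_left frob_inner_diff_right)
  then show ?thesis unfolding frob_inner_self of_real_add[symmetric] of_real_eq_iff .
qed

text \<open>After the triangle inequality this is the real Cauchy-Schwarz inequality for the moduli
  of the entries, indexed by pairs of multi-indices.\<close>

lemma frob_inner_Cauchy_Schwarz:
  "cmod (frob_inner Is Js X Y) \<le> frobenius_norm Is Js X * frobenius_norm Is Js Y"
proof -
  let ?K = "multi_indices Is \<times> multi_indices Js"
  let ?x = "\<lambda>(i, j). cmod (X i j)" and ?y = "\<lambda>(i, j). cmod (Y i j)"
  have "cmod (frob_inner Is Js X Y) \<le> (\<Sum>p\<in>?K. ?x p * ?y p)"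
    unfolding frob_inner_def sum.cartesian_product
    by (rule order_trans[OF norm_sum]) (simp add: norm_mult case_prod_beta)
  also have "\<dots> \<le> L2_set ?x ?K * L2_set ?y ?K"
    using L2_set_mult_ineq[of ?x ?y ?K] by (simp add: case_prod_beta)
  finally show ?thesis
    by (simp add: L2_set_def frobenius_norm_def sum.cartesian_product case_prod_beta)
qed

section \<open>Diagonalization of Hermitian tensors\<close>

text \<open>With \<open>d\<close> constantly 1 this is the identity tensor of the format. The
  cut-off to the format keeps it in \<open>tensors Js Js\<close>, so it erases rows that lie
  outside.\<close>

definition diag_tensor :: "nat list \<Rightarrow> (nat list \<Rightarrow> real) \<Rightarrow> tensor" where
  "diag_tensor Js d = (\<lambda>i j. if i = j \<and> i \<in> multi_indices Js then complex_of_real (d i) else 0)"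

lemma diag_tensor_mult_index:
  "i \<in> multi_indices Js \<Longrightarrow> (diag_tensor Js d \<cdot>\<^bsub>Js\<^esub> X) i j = complex_of_real (d i) * X i j"
  by (simp add: einstein_prod_def diag_tensor_def sum.remove[of _ i] sum.neutral)

lemma diag_tensor_mult:
  "diag_tensor Js d \<cdot>\<^bsub>Js\<^esub> diag_tensor Js e = diag_tensor Js (\<lambda>k. d k * e k)"
proof (intro ext)
  fix i j
  show "(diag_tensor Js d \<cdot>\<^bsub>Js\<^esub> diag_tensor Js e) i j = diag_tensor Js (\<lambda>k. d k * e k) i j"
  proof (cases "i \<in> multi_indices Js")
    case True
    then show ?thesis unfolding diag_tensor_mult_index[OF True] by (simp add: diag_tensor_def)
  qed (simp add: diag_tensor_def einstein_prod_def)
qed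

lemma conj_transpose_diag_tensor [simp]: "conj_transpose (diag_tensor Js d) = diag_tensor Js d"
  by (auto simp: conj_transpose_def diag_tensor_def fun_eq_iff)

section \<open>Transport between tensors and matrices\<close>

lemma linear_index_less: "j \<in> multi_indices Js \<Longrightarrow> linear_index Js j < prod_list Js"
  using linear_index_bij by (auto simp: bij_betw_def)

lemma linear_index_eq_iff:
  "i \<in> multi_indices Js \<Longrightarrow> j \<in> multi_indices Js \<Longrightarrow> linear_index Js i = linear_index Js j \<longleftrightarrow> i = j"
  using bij_betw_imp_inj_on[OF linear_index_bij] by (rule inj_on_eq_iff)

lemma linear_index_surj:
  assumes "p < prod_list Js" obtains j where "j \<in> multi_indices Js" "p = linear_index Js j"
  using assms linear_index_bij[of Js] unfolding bij_betw_def by blast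

lemma unfold_tensor_carrier [simp]: "unfold_tensor Is Js A \<in> carrier_mat (prod_list Is) (prod_list Js)"
  by (simp add: unfold_tensor_def)

lemma eq_matI_multi_index:
  assumes "M \<in> carrier_mat (prod_list Is) (prod_list Js)" "M' \<in> carrier_mat (prod_list Is) (prod_list Js)"
    and "\<And>i j. i \<in> multi_indices Is \<Longrightarrow> j \<in> multi_indices Js \<Longrightarrow>
      M $$ (linear_index Is i, linear_index Js j) = M' $$ (linear_index Is i, linear_index Js j)"
  shows "M = M'"
  using assms by (intro eq_matI) (auto elim!: linear_index_surj)

lemma mult_mat_multi_index:
  assumes "M \<in> carrier_mat (prod_list Is) (prod_list Js)" "M' \<in> carrier_mat (prod_list Js) (prod_list Ks)"
    and "i \<in> multi_indices Is" "k \<in> multi_indices Ks"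
  shows "(M * M') $$ (linear_index Is i, linear_index Ks k)
    = (\<Sum>j\<in>multi_indices Js. M $$ (linear_index Is i, linear_index Js j) * M' $$ (linear_index Js j, linear_index Ks k))"
  using assms
  by (simp only: mult_mat_index_sum[OF assms(1,2)] linear_index_less
      sum.reindex_bij_betw[OF linear_index_bij, of "\<lambda>l. M $$ (linear_index Is i, l) * M' $$ (l, linear_index Ks k)"])

text \<open>The contracted multi-index is linearized in the same way as column index of the left
  factor and row index of the right one, so reindexing along the bijection
  \<open>linear_index\<close> gives the matrix product.\<close>

lemma unfold_einstein:
  "unfold_tensor Is Ks (A \<cdot>\<^bsub>Js\<^esub> B) = unfold_tensor Is Js A * unfold_tensor Js Ks B"
  by (rule eq_matI_multi_index[of _ Is Ks])
    (auto intro!: mult_carrier_mat[of _ _ "prod_list Js"]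
      simp: mult_mat_multi_index[of _ Is Js _ Ks] unfold_tensor_entry einstein_prod_def)

lemma unfold_conj_transpose:
  "unfold_tensor Js Is (conj_transpose A) = mat_adjoint (unfold_tensor Is Js A)"
proof (rule eq_matI_multi_index[of _ Js Is])
  fix j i assume "j \<in> multi_indices Js" "i \<in> multi_indices Is"
  then show "unfold_tensor Js Is (conj_transpose A) $$ (linear_index Js j, linear_index Is i)
      = mat_adjoint (unfold_tensor Is Js A) $$ (linear_index Js j, linear_index Is i)"
    using carrier_matD[OF unfold_tensor_carrier[of Is Js A]]
    by (simp add: unfold_tensor_entry linear_index_less conj_transpose_def)
qed auto

text \<open>The inverse of the unfolding, used to carry matrix factorizations back to tensors; the
  value 0 outside the format puts the result in \<open>tensors Is Js\<close>.\<close>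

definition fold_tensor :: "nat list \<Rightarrow> nat list \<Rightarrow> complex mat \<Rightarrow> tensor" where
  "fold_tensor Is Js M = (\<lambda>i j. if i \<in> multi_indices Is \<and> j \<in> multi_indices Js
     then M $$ (linear_index Is i, linear_index Js j) else 0)"

lemma fold_unfold_tensor: "A \<in> tensors Is Js \<Longrightarrow> fold_tensor Is Js (unfold_tensor Is Js A) = A"
  by (intro ext) (auto simp: fold_tensor_def unfold_tensor_entry tensors_def)

lemma fold_mult:
  assumes "M \<in> carrier_mat (prod_list Is) (prod_list Js)" "M' \<in> carrier_mat (prod_list Js) (prod_list Ks)"
  shows "fold_tensor Is Ks (M * M') = fold_tensor Is Js M \<cdot>\<^bsub>Js\<^esub> fold_tensor Js Ks M'"
  by (intro ext) (auto simp: fold_tensor_def einstein_prod_def mult_mat_multi_index[OF assms])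

lemma fold_mat_adjoint:
  assumes "M \<in> carrier_mat (prod_list Is) (prod_list Js)"
  shows "fold_tensor Js Is (mat_adjoint M) = conj_transpose (fold_tensor Is Js M)"
  using carrier_matD[OF assms]
  by (intro ext) (simp add: fold_tensor_def conj_transpose_def linear_index_less)

lemma fold_real_diag_mat:
  "fold_tensor Js Js (real_diag_mat (prod_list Js) d) = diag_tensor Js (\<lambda>j. d (linear_index Js j))"
  by (intro ext) (auto simp: fold_tensor_def diag_tensor_def real_diag_mat_def linear_index_less linear_index_eq_iff)

lemma fold_one_mat: "fold_tensor Js Js (1\<^sub>m (prod_list Js)) = diag_tensor Js (\<lambda>_. 1)"
  by (intro ext) (auto simp: fold_tensor_def diag_tensor_def linear_index_less linear_index_eq_iff)

section \<open>Spectral decomposition and functional calculus of Hermitian tensors\<close>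

definition unitary_tensor :: "nat list \<Rightarrow> tensor \<Rightarrow> bool" where
  "unitary_tensor Js U \<longleftrightarrow> U \<in> tensors Js Js \<and>
     conj_transpose U \<cdot>\<^bsub>Js\<^esub> U = diag_tensor Js (\<lambda>_. 1) \<and>
     U \<cdot>\<^bsub>Js\<^esub> conj_transpose U = diag_tensor Js (\<lambda>_. 1)"

text \<open>For a fixed unitary \<open>U\<close> these tensors form a commutative algebra in which
  products act pointwise on \<open>d\<close>; identities about functions of one Hermitian tensor
  become identities about real numbers.\<close>

definition spectral_tensor :: "nat list \<Rightarrow> tensor \<Rightarrow> (nat list \<Rightarrow> real) \<Rightarrow> tensor" where
  "spectral_tensor Js U d = U \<cdot>\<^bsub>Js\<^esub> (diag_tensor Js d \<cdot>\<^bsub>Js\<^esub> conj_transpose U)"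

text \<open>Unfold, diagonalize the matrix, fold the factors back. The clause on eigenvalues links
  \<open>d\<close> to singular values, which are defined through the unfolded Gram tensor.\<close>

lemma hermitian_tensor_diagonalization:
  assumes G: "G \<in> tensors Js Js" "conj_transpose G = G"
  obtains U d where "unitary_tensor Js U" "G = spectral_tensor Js U d"
    "\<And>j. j \<in> multi_indices Js \<Longrightarrow> eigenvalue (unfold_tensor Js Js G) (complex_of_real (d j))"
proof -
  let ?n = "prod_list Js" and ?M = "unfold_tensor Js Js G" and ?fold = "fold_tensor Js Js"
  have "mat_adjoint ?M = ?M" by (metis unfold_conj_transpose G(2))
  then obtain V e where V: "V \<in> carrier_mat ?n ?n"
    and VV: "mat_adjoint V * V = 1\<^sub>m ?n" "V * mat_adjoint V = 1\<^sub>m ?n"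
    and M: "?M = V * real_diag_mat ?n e * mat_adjoint V"
    using hermitian_diagonalization[OF unfold_tensor_carrier] by metis
  let ?U = "?fold V" and ?d = "\<lambda>j. e (linear_index Js j)"
  note fold = fold_mult[of _ Js Js _ Js] fold_mat_adjoint[OF V] fold_real_diag_mat fold_one_mat
  have Vs: "mat_adjoint V \<in> carrier_mat ?n ?n" using V by simp
  have "unitary_tensor Js ?U"
    using arg_cong[OF VV(1), of ?fold] arg_cong[OF VV(2), of ?fold] V Vs
    by (auto simp: unitary_tensor_def fold) (auto simp: tensors_def fold_tensor_def)
  moreover have "G = ?fold ?M" by (simp add: fold_unfold_tensor G(1))
  then have "G = spectral_tensor Js ?U ?d"
    using V Vs mult_carrier_mat[OF V real_diag_mat_carrier]
    by (simp add: M fold spectral_tensor_def einstein_assoc del: assoc_mult_mat)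
  moreover have "eigenvalue ?M (complex_of_real (?d j))" if "j \<in> multi_indices Js" for j
    unfolding M by (rule eigenvalue_unitary_diag[OF V VV linear_index_less[OF that]])
  ultimately show thesis by (rule that)
qed

text \<open>The identity tensor erases rows outside the format, but a product that starts with a
  diagonal tensor has only zeros there.\<close>

lemma diag_tensor_one_mult:
  "diag_tensor Js (\<lambda>_. 1) \<cdot>\<^bsub>Js\<^esub> (diag_tensor Js e \<cdot>\<^bsub>Js\<^esub> X) = diag_tensor Js e \<cdot>\<^bsub>Js\<^esub> X"
  by (simp add: diag_tensor_mult flip: einstein_assoc)

lemma spectral_tensor_mult:
  assumes "unitary_tensor Js U"
  shows "spectral_tensor Js U d \<cdot>\<^bsub>Js\<^esub> spectral_tensor Js U e = spectral_tensor Js U (\<lambda>k. d k * e k)"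
proof -
  have "spectral_tensor Js U d \<cdot>\<^bsub>Js\<^esub> spectral_tensor Js U e
      = U \<cdot>\<^bsub>Js\<^esub> (diag_tensor Js d \<cdot>\<^bsub>Js\<^esub> ((conj_transpose U \<cdot>\<^bsub>Js\<^esub> U)
          \<cdot>\<^bsub>Js\<^esub> (diag_tensor Js e \<cdot>\<^bsub>Js\<^esub> conj_transpose U)))"
    by (simp add: spectral_tensor_def einstein_assoc)
  also have "\<dots> = U \<cdot>\<^bsub>Js\<^esub> ((diag_tensor Js d \<cdot>\<^bsub>Js\<^esub> diag_tensor Js e) \<cdot>\<^bsub>Js\<^esub> conj_transpose U)"
    using assms by (simp add: unitary_tensor_def diag_tensor_one_mult einstein_assoc)
  finally show ?thesis by (simp add: spectral_tensor_def diag_tensor_mult)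
qed

lemma conj_transpose_spectral_tensor [simp]:
  "conj_transpose (spectral_tensor Js U d) = spectral_tensor Js U d"
  by (simp add: spectral_tensor_def conj_transpose_einstein einstein_assoc)

lemma spectral_tensor_tensors:
  "unitary_tensor Js U \<Longrightarrow> spectral_tensor Js U d \<in> tensors Js Js"
  unfolding spectral_tensor_def unitary_tensor_def
  by (intro einstein_tensors conj_transpose_tensors) (auto simp: diag_tensor_def tensors_def)

section \<open>The Moore--Penrose inverse\<close>

text \<open>The trace of \<open>W\<^sup>H W\<close> is the squared Frobenius norm of
  \<open>W\<close>. This allows \<open>A\<^sup>H\<close> to be cancelled from the left
  below.\<close>

lemma gram_tensor_eq_zero:
  assumes "W \<in> tensors Is Js" "conj_transpose W \<cdot>\<^bsub>Is\<^esub> W = 0"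
  shows "W = 0"
proof -
  have "frob_inner Is Js W W = (\<Sum>j\<in>multi_indices Js. (conj_transpose W \<cdot>\<^bsub>Is\<^esub> W) j j)"
    unfolding frob_inner_def by (subst sum.swap) (simp add: einstein_prod_def conj_transpose_def)
  then have "(frobenius_norm Is Js W)\<^sup>2 = 0"
    using assms(2) by (simp add: frob_inner_self)
  then have "\<forall>i\<in>multi_indices Is. \<forall>j\<in>multi_indices Js. W i j = 0"
    unfolding frobenius_norm_sq by (simp add: sum_nonneg_eq_0_iff sum_nonneg)
  then show ?thesis using assms(1) by (auto simp: tensors_def fun_eq_iff)
qed

lemma is_MP_inverse_exists:
  assumes A: "A \<in> tensors Is Js"
  shows "\<exists>Y. is_MP_inverse Is Js A Y"
proof -
  \<comment> \<open>The inverse is \<open>(A\<^sup>H A)\<^sup>\<dagger> A\<^sup>H\<close>, where \<open>T = (A\<^sup>H A)\<^sup>\<dagger>\<close> inverts the nonzero eigenvalues (\<open>inverse 0 = 0\<close>).\<close>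
  let ?H = "conj_transpose A" and ?G = "conj_transpose A \<cdot>\<^bsub>Is\<^esub> A"
  have "?G \<in> tensors Js Js" "conj_transpose ?G = ?G"
    using A by (auto intro: einstein_tensors conj_transpose_tensors simp: conj_transpose_einstein)
  then obtain U d where U: "unitary_tensor Js U" and G: "?G = spectral_tensor Js U d"
    using hermitian_tensor_diagonalization by metis
  define T where "T = spectral_tensor Js U (\<lambda>k. inverse (d k))"
  define Y where "Y = T \<cdot>\<^bsub>Js\<^esub> ?H"
  have T: "T \<in> tensors Js Js" "conj_transpose T = T"
    using U by (auto simp: T_def spectral_tensor_tensors)
  have GT: "conj_transpose (T \<cdot>\<^bsub>Js\<^esub> ?G) = T \<cdot>\<^bsub>Js\<^esub> ?G"
    "?G \<cdot>\<^bsub>Js\<^esub> (T \<cdot>\<^bsub>Js\<^esub> ?G) = ?G" "T \<cdot>\<^bsub>Js\<^esub> (?G \<cdot>\<^bsub>Js\<^esub> T) = T"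
  proof -
    have inv: "(\<lambda>k. d k * (inverse (d k) * d k)) = d"
      "(\<lambda>k. inverse (d k) * (d k * inverse (d k))) = (\<lambda>k. inverse (d k))"
      by (rule ext, simp add: field_simps)+
    show "conj_transpose (T \<cdot>\<^bsub>Js\<^esub> ?G) = T \<cdot>\<^bsub>Js\<^esub> ?G"
      "?G \<cdot>\<^bsub>Js\<^esub> (T \<cdot>\<^bsub>Js\<^esub> ?G) = ?G" "T \<cdot>\<^bsub>Js\<^esub> (?G \<cdot>\<^bsub>Js\<^esub> T) = T"
      unfolding G T_def by (simp_all only: spectral_tensor_mult[OF U] conj_transpose_spectral_tensor inv)
  qed
  let ?TG = "T \<cdot>\<^bsub>Js\<^esub> ?G"
  \<comment> \<open>The first Penrose equation. From \<open>G T G = G\<close> the difference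
    \<open>W = A T G - A\<close> satisfies \<open>A\<^sup>H W = 0\<close>, and
    \<open>W\<^sup>H W\<close> is a combination of multiples of \<open>A\<^sup>H W\<close>.\<close>
  have "A \<cdot>\<^bsub>Js\<^esub> ?TG - A = 0"
  proof (rule gram_tensor_eq_zero)
    have "A \<cdot>\<^bsub>Js\<^esub> ?TG \<in> tensors Is Js"
      using A T by (intro einstein_tensors conj_transpose_tensors)
    then show "A \<cdot>\<^bsub>Js\<^esub> ?TG - A \<in> tensors Is Js" using A by (auto simp: tensors_def)
    have "?H \<cdot>\<^bsub>Is\<^esub> (A \<cdot>\<^bsub>Js\<^esub> ?TG - A) = 0"
      using GT(2) by (simp add: einstein_diff_right einstein_assoc)
    moreover have "conj_transpose (A \<cdot>\<^bsub>Js\<^esub> ?TG - A) \<cdot>\<^bsub>Is\<^esub> W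
        = ?TG \<cdot>\<^bsub>Js\<^esub> (?H \<cdot>\<^bsub>Is\<^esub> W) - ?H \<cdot>\<^bsub>Is\<^esub> W" for W
      by (simp only: conj_transpose_diff conj_transpose_einstein[of _ A] GT(1) einstein_diff_left einstein_assoc)
    moreover have "?TG \<cdot>\<^bsub>Js\<^esub> 0 = 0" by (simp add: einstein_prod_def fun_eq_iff)
    ultimately show "conj_transpose (A \<cdot>\<^bsub>Js\<^esub> ?TG - A) \<cdot>\<^bsub>Is\<^esub> (A \<cdot>\<^bsub>Js\<^esub> ?TG - A) = 0" by simp
  qed
  then have ATG: "A \<cdot>\<^bsub>Js\<^esub> (T \<cdot>\<^bsub>Js\<^esub> (?H \<cdot>\<^bsub>Is\<^esub> A)) = A" by simp
  have "Y \<in> tensors Js Is"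
    unfolding Y_def using A T by (intro einstein_tensors conj_transpose_tensors)
  moreover have "T \<cdot>\<^bsub>Js\<^esub> (?H \<cdot>\<^bsub>Is\<^esub> (A \<cdot>\<^bsub>Js\<^esub> (T \<cdot>\<^bsub>Js\<^esub> ?H))) = T \<cdot>\<^bsub>Js\<^esub> ?H"
    using arg_cong[OF GT(3), of "\<lambda>Z. Z \<cdot>\<^bsub>Js\<^esub> ?H"] by (simp add: einstein_assoc)
  \<comment> \<open>The two symmetry conditions: \<open>A Y = A T A\<^sup>H\<close> is Hermitian
    because \<open>T\<close> is, and \<open>Y A = T G\<close> by \<open>GT(1)\<close>.\<close>
  ultimately have "is_MP_inverse Is Js A Y"
    using GT(1) ATG by (simp add: is_MP_inverse_def Y_def einstein_assoc conj_transpose_einstein T(2))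
  then show ?thesis by (intro exI[of _ Y])
qed

text \<open>The products agree, since \<open>A Y = (A Z)(A Y)\<close> is the conjugate transpose of
  \<open>(A Y)(A Z) = A Z\<close>, which is Hermitian; likewise \<open>Y A = Z A\<close>. Then
  \<open>Y = Y A Y = Y A Z = Z A Z = Z\<close>.\<close>

lemma is_MP_inverse_unique:
  assumes Y: "is_MP_inverse Is Js A Y" and Z: "is_MP_inverse Is Js A Z"
  shows "Y = Z"
proof -
  note y = Y[unfolded is_MP_inverse_def] and z = Z[unfolded is_MP_inverse_def]
  have "A \<cdot>\<^bsub>Js\<^esub> Y = conj_transpose ((A \<cdot>\<^bsub>Js\<^esub> Y) \<cdot>\<^bsub>Is\<^esub> (A \<cdot>\<^bsub>Js\<^esub> Z))"
    using y z by (metis conj_transpose_einstein einstein_assoc)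
  also have "\<dots> = A \<cdot>\<^bsub>Js\<^esub> Z"
    using y z by (metis einstein_assoc)
  finally have AY: "A \<cdot>\<^bsub>Js\<^esub> Y = A \<cdot>\<^bsub>Js\<^esub> Z" .
  have "Y \<cdot>\<^bsub>Is\<^esub> A = conj_transpose ((Z \<cdot>\<^bsub>Is\<^esub> A) \<cdot>\<^bsub>Js\<^esub> (Y \<cdot>\<^bsub>Is\<^esub> A))"
    using y z by (metis conj_transpose_einstein einstein_assoc)
  also have "\<dots> = Z \<cdot>\<^bsub>Is\<^esub> A"
    using y z by (metis einstein_assoc)
  finally have YA: "Y \<cdot>\<^bsub>Is\<^esub> A = Z \<cdot>\<^bsub>Is\<^esub> A" .
  show ?thesis using y z AY YA by (metis einstein_assoc)
qed

lemma MP_inverse: "A \<in> tensors Is Js \<Longrightarrow> is_MP_inverse Is Js A (MP_inverse Is Js A)"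
  unfolding MP_inverse_def using is_MP_inverse_exists is_MP_inverse_unique by (metis theI)

section \<open>The spectral norm\<close>

text \<open>Each singular value is the root of one of the finitely many eigenvalues of the Gram
  matrix; finiteness makes the \<open>Max\<close> in \<open>spectral_norm\<close> an upper
  bound.\<close>

lemma finite_singular_values:
  assumes "Z \<in> carrier_mat m n"
  shows "finite (singular_values Z)"
proof -
  have "mat_adjoint Z * Z \<in> carrier_mat n n"
    using assms by (intro mult_carrier_mat[of _ n m]) auto
  from card_finite_spectrum(1)[OF this]
  have "finite ((\<lambda>z. sqrt (Re z)) ` spectrum (mat_adjoint Z * Z))" by simp
  moreover have "singular_values Z \<subseteq> (\<lambda>z. sqrt (Re z)) ` spectrum (mat_adjoint Z * Z)"
    by (auto simp: singular_values_def spectrum_def image_iff intro!: exI)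
  ultimately show ?thesis by (rule rev_finite_subset)
qed

text \<open>Diagonalizing \<open>A\<^sup>H A\<close> turns the squared norm of \<open>A X\<close>
  into a sum of squared entries of \<open>U\<^sup>H X\<close> weighted by the eigenvalues, each at
  most the square of the spectral norm.\<close>

lemma frobenius_norm_mult_spectral:
  assumes A: "A \<in> tensors Is Js" and pos: "0 < prod_list Js"
  shows "0 \<le> spectral_norm Is Js A"
    and "frobenius_norm Is Ks (A \<cdot>\<^bsub>Js\<^esub> X) \<le> spectral_norm Is Js A * frobenius_norm Js Ks X"
proof -
  let ?G = "conj_transpose A \<cdot>\<^bsub>Is\<^esub> A" and ?\<sigma> = "spectral_norm Is Js A"
  have "?G \<in> tensors Js Js" "conj_transpose ?G = ?G"
    using A by (auto intro: einstein_tensors conj_transpose_tensors simp: conj_transpose_einstein)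
  then obtain U d where U: "unitary_tensor Js U" and G: "?G = spectral_tensor Js U d"
    and ev: "\<And>j. j \<in> multi_indices Js \<Longrightarrow> eigenvalue (unfold_tensor Js Js ?G) (complex_of_real (d j))"
    using hermitian_tensor_diagonalization by metis
  let ?UH = "conj_transpose U"
  have "?UH \<cdot>\<^bsub>Js\<^esub> (?G \<cdot>\<^bsub>Js\<^esub> U)
      = (?UH \<cdot>\<^bsub>Js\<^esub> U) \<cdot>\<^bsub>Js\<^esub> (diag_tensor Js d \<cdot>\<^bsub>Js\<^esub> (?UH \<cdot>\<^bsub>Js\<^esub> U))"
    unfolding G spectral_tensor_def by (simp add: einstein_assoc)
  also have "\<dots> = diag_tensor Js d"
    using U by (simp add: unitary_tensor_def diag_tensor_mult)
  finally have diag: "conj_transpose (A \<cdot>\<^bsub>Js\<^esub> U) \<cdot>\<^bsub>Is\<^esub> (A \<cdot>\<^bsub>Js\<^esub> U) = diag_tensor Js d"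
    by (simp add: conj_transpose_einstein einstein_assoc)
  \<comment> \<open>The number \<open>d j\<close> is the squared length of column \<open>j\<close>
    of \<open>A U\<close>.\<close>
  have d0: "0 \<le> d j" if "j \<in> multi_indices Js" for j
  proof -
    have "complex_of_real (d j) = (\<Sum>i\<in>multi_indices Is. complex_of_real ((cmod ((A \<cdot>\<^bsub>Js\<^esub> U) i j))\<^sup>2))"
      using fun_cong[OF fun_cong[OF diag], of j j] that
      unfolding complex_norm_square
      by (simp add: diag_tensor_def conj_transpose_def einstein_prod_def[of Is] mult.commute)
    then have "d j = (\<Sum>i\<in>multi_indices Is. (cmod ((A \<cdot>\<^bsub>Js\<^esub> U) i j))\<^sup>2)"
      unfolding of_real_sum[symmetric] of_real_eq_iff .
    then show ?thesis by (simp add: sum_nonneg)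
  qed
  have sv: "sqrt (d j) \<in> singular_values (unfold_tensor Is Js A)" if "j \<in> multi_indices Js" for j
    using ev[OF that] d0[OF that]
    by (simp add: singular_values_def unfold_einstein[of Js Js Is] unfold_conj_transpose
        del: of_real_power)
  note fin = finite_singular_values[OF unfold_tensor_carrier[of Is Js A]]
  have le: "sqrt (d j) \<le> ?\<sigma>" if "j \<in> multi_indices Js" for j
    unfolding spectral_norm_def by (rule Max_ge[OF fin sv[OF that]])
  \<comment> \<open>Positivity of the format provides a multi-index, so the set of singular values
    is nonempty and its maximum dominates a nonnegative number.\<close>
  obtain j where j: "j \<in> multi_indices Js" using linear_index_surj[OF pos] by blast
  show \<sigma>: "0 \<le> ?\<sigma>" using le[OF j] d0[OF j] by (meson order_trans real_sqrt_ge_zero)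
  have d\<sigma>: "d j \<le> ?\<sigma>\<^sup>2" if "j \<in> multi_indices Js" for j
    using le[OF that] \<sigma> d0[OF that] by (metis real_sqrt_le_iff real_sqrt_abs abs_of_nonneg)
  let ?Z = "?UH \<cdot>\<^bsub>Js\<^esub> X"
  have "frob_inner Is Ks (A \<cdot>\<^bsub>Js\<^esub> X) (A \<cdot>\<^bsub>Js\<^esub> X) = frob_inner Js Ks X (?G \<cdot>\<^bsub>Js\<^esub> X)"
    by (simp add: frob_inner_adjoint_left einstein_assoc)
  also have "\<dots> = frob_inner Js Ks ?Z (diag_tensor Js d \<cdot>\<^bsub>Js\<^esub> ?Z)"
    unfolding G by (simp add: spectral_tensor_def einstein_assoc frob_inner_adjoint_left)
  also have "\<dots> = complex_of_real (\<Sum>j\<in>multi_indices Js. \<Sum>k\<in>multi_indices Ks. d j * (cmod (?Z j k))\<^sup>2)"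
    unfolding frob_inner_def of_real_sum of_real_mult complex_norm_square
    by (intro sum.cong refl) (simp add: diag_tensor_mult_index)
  finally have "(frobenius_norm Is Ks (A \<cdot>\<^bsub>Js\<^esub> X))\<^sup>2
      = (\<Sum>j\<in>multi_indices Js. \<Sum>k\<in>multi_indices Ks. d j * (cmod (?Z j k))\<^sup>2)"
    unfolding frob_inner_self of_real_eq_iff .
  also have "\<dots> \<le> (\<Sum>j\<in>multi_indices Js. \<Sum>k\<in>multi_indices Ks. ?\<sigma>\<^sup>2 * (cmod (?Z j k))\<^sup>2)"
    by (intro sum_mono mult_right_mono d\<sigma>) auto
  also have "\<dots> = ?\<sigma>\<^sup>2 * (frobenius_norm Js Ks ?Z)\<^sup>2"
    by (simp add: frobenius_norm_sq sum_distrib_left)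
  \<comment> \<open>Unitary invariance of the norm. The inner product only sees rows inside the
    format, where \<open>U U\<^sup>H\<close> acts as the identity.\<close>
  also have "frob_inner Js Ks ?Z ?Z = frob_inner Js Ks X ((U \<cdot>\<^bsub>Js\<^esub> ?UH) \<cdot>\<^bsub>Js\<^esub> X)"
    by (simp add: frob_inner_adjoint_left einstein_assoc)
  then have "frob_inner Js Ks ?Z ?Z = frob_inner Js Ks X X"
    using U by (simp add: unitary_tensor_def frob_inner_def diag_tensor_mult_index)
  then have "(frobenius_norm Js Ks ?Z)\<^sup>2 = (frobenius_norm Js Ks X)\<^sup>2"
    unfolding frob_inner_self of_real_eq_iff .
  finally have "(frobenius_norm Is Ks (A \<cdot>\<^bsub>Js\<^esub> X))\<^sup>2 \<le> (?\<sigma> * frobenius_norm Js Ks X)\<^sup>2"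
    by (simp add: power_mult_distrib)
  then show "frobenius_norm Is Ks (A \<cdot>\<^bsub>Js\<^esub> X) \<le> ?\<sigma> * frobenius_norm Js Ks X"
    by (rule power2_le_imp_le) (simp add: \<sigma>)
qed

lemma frobenius_norm_mult_spectral_right:
  assumes A: "A \<in> tensors Is Js" and pos: "0 < prod_list Js"
  shows "frobenius_norm Ks Js (X \<cdot>\<^bsub>Is\<^esub> A) \<le> frobenius_norm Ks Is X * spectral_norm Is Js A"
proof -
  \<comment> \<open>With \<open>W = (XA)\<^sup>H\<close>: \<open>\<parallel>W\<parallel>\<^sup>2 = \<langle>X\<^sup>H, A W\<rangle> \<le> \<parallel>X\<parallel> \<parallel>A\<parallel>\<^sub>2 \<parallel>W\<parallel>\<close>, so only the bound for left factors is needed.\<close>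
  let ?f = "frobenius_norm Ks Js (X \<cdot>\<^bsub>Is\<^esub> A)"
  let ?W = "conj_transpose A \<cdot>\<^bsub>Is\<^esub> conj_transpose X"
  have W: "frobenius_norm Js Ks ?W = ?f"
    by (simp flip: conj_transpose_einstein)
  have "complex_of_real (?f\<^sup>2) = frob_inner Is Ks (conj_transpose X) (A \<cdot>\<^bsub>Js\<^esub> ?W)"
    using frob_inner_self[of Js Ks ?W] by (simp add: W frob_inner_adjoint_left)
  then have "?f\<^sup>2 = cmod (frob_inner Is Ks (conj_transpose X) (A \<cdot>\<^bsub>Js\<^esub> ?W))"
    by (metis abs_power2 norm_of_real real_norm_def)
  also have "\<dots> \<le> frobenius_norm Ks Is X * frobenius_norm Is Ks (A \<cdot>\<^bsub>Js\<^esub> ?W)"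
    using frob_inner_Cauchy_Schwarz[of Is Ks "conj_transpose X"] by simp
  also have "\<dots> \<le> frobenius_norm Ks Is X * (spectral_norm Is Js A * ?f)"
    using frobenius_norm_mult_spectral(2)[OF A pos, of Ks ?W] by (intro mult_left_mono) (auto simp: W)
  finally have "?f * ?f \<le> (frobenius_norm Ks Is X * spectral_norm Is Js A) * ?f"
    by (simp add: power2_eq_square mult.assoc)
  \<comment> \<open>One factor \<open>?f\<close> is cancelled; if it is 0, the claim is that the
    right side is nonnegative.\<close>
  then show ?thesis
    using frobenius_norm_mult_spectral(1)[OF A pos] frobenius_norm_nonneg[of Ks Js "X \<cdot>\<^bsub>Is\<^esub> A"]
    by (cases "?f = 0") (auto simp: mult_le_cancel_right)
qed

section \<open>The perturbation bound\<close>

text \<open>As \<open>R\<close> is an orthogonal projection, \<open>R X\<close> is orthogonal to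
  \<open>R X - X\<close>, and Pythagoras applies.\<close>

lemma frobenius_norm_projection_left:
  assumes "conj_transpose R = R" "R \<cdot>\<^bsub>Is\<^esub> R = R"
  shows "(frobenius_norm Is Js (X - R \<cdot>\<^bsub>Is\<^esub> X))\<^sup>2
    = (frobenius_norm Is Js X)\<^sup>2 - (frobenius_norm Is Js (R \<cdot>\<^bsub>Is\<^esub> X))\<^sup>2"
proof -
  have "R \<cdot>\<^bsub>Is\<^esub> (R \<cdot>\<^bsub>Is\<^esub> X) = R \<cdot>\<^bsub>Is\<^esub> X" by (metis assms(2) einstein_assoc)
  then have "frob_inner Is Js (R \<cdot>\<^bsub>Is\<^esub> X) (R \<cdot>\<^bsub>Is\<^esub> X - X) = 0"
    using assms by (simp add: frob_inner_adjoint_left einstein_diff_right)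
  from frobenius_norm_diff_orthogonal[OF this] 
  have "(frobenius_norm Is Js X)\<^sup>2 = (frobenius_norm Is Js (R \<cdot>\<^bsub>Is\<^esub> X))\<^sup>2
    + (frobenius_norm Is Js (R \<cdot>\<^bsub>Is\<^esub> X - X))\<^sup>2" by simp
  then show ?thesis
    using frobenius_norm_uminus[of Is Js "X - R \<cdot>\<^bsub>Is\<^esub> X"] by simp
qed

lemma frobenius_norm_projection_right:
  assumes "conj_transpose Q = Q" "Q \<cdot>\<^bsub>Js\<^esub> Q = Q"
  shows "(frobenius_norm Is Js (X - X \<cdot>\<^bsub>Js\<^esub> Q))\<^sup>2
    = (frobenius_norm Is Js X)\<^sup>2 - (frobenius_norm Is Js (X \<cdot>\<^bsub>Js\<^esub> Q))\<^sup>2"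
proof -
  have ct: "conj_transpose (X \<cdot>\<^bsub>Js\<^esub> Q) = Q \<cdot>\<^bsub>Js\<^esub> conj_transpose X"
    by (simp add: conj_transpose_einstein assms(1))
  show ?thesis
    using frobenius_norm_projection_left[OF assms, of Is "conj_transpose X"]
    by (simp flip: ct conj_transpose_diff)
qed

text \<open>The asymmetric half of the argument: the last two terms of the bound trade places when
  \<open>A\<close> and \<open>B\<close> are exchanged.\<close>

lemma wedin_bound:
  assumes A: "A \<in> tensors Is Js" and B: "B \<in> tensors Is Js"
    and pos: "0 < prod_list Is"
    and mpX: "is_MP_inverse Is Js A X" and mpY: "is_MP_inverse Is Js B Y"
    and c: "spectral_norm Js Is X * spectral_norm Js Is Y \<le> c"
      "(spectral_norm Js Is X)\<^sup>2 \<le> c" "(spectral_norm Js Is Y)\<^sup>2 \<le> c"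
  shows "(frobenius_norm Js Is (Y - X))\<^sup>2
    \<le> c\<^sup>2 * ((frobenius_norm Is Js (B - A))\<^sup>2
        + (frobenius_norm Is Js ((B \<cdot>\<^bsub>Js\<^esub> Y) \<cdot>\<^bsub>Is\<^esub> ((B - A) \<cdot>\<^bsub>Js\<^esub> (X \<cdot>\<^bsub>Is\<^esub> A))))\<^sup>2
        - (frobenius_norm Is Js ((A \<cdot>\<^bsub>Js\<^esub> X) \<cdot>\<^bsub>Is\<^esub> ((B - A) \<cdot>\<^bsub>Js\<^esub> (Y \<cdot>\<^bsub>Is\<^esub> B))))\<^sup>2)"
proof -
  let ?E = "B - A" and ?a = "spectral_norm Js Is X" and ?b = "spectral_norm Js Is Y"
  note x = mpX[unfolded is_MP_inverse_def] and y = mpY[unfolded is_MP_inverse_def]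
  define P where "P = B \<cdot>\<^bsub>Js\<^esub> Y"
  define Q where "Q = Y \<cdot>\<^bsub>Is\<^esub> B"
  define R where "R = A \<cdot>\<^bsub>Js\<^esub> X"
  define S where "S = X \<cdot>\<^bsub>Is\<^esub> A"
  have herm: "conj_transpose P = P" "conj_transpose Q = Q" "conj_transpose R = R" "conj_transpose S = S"
    using x y by (auto simp: P_def Q_def R_def S_def)
  have abs: "R \<cdot>\<^bsub>Is\<^esub> A = A" "X \<cdot>\<^bsub>Is\<^esub> R = X" "S \<cdot>\<^bsub>Js\<^esub> X = X" "A \<cdot>\<^bsub>Js\<^esub> S = A"
    "P \<cdot>\<^bsub>Is\<^esub> B = B" "Y \<cdot>\<^bsub>Is\<^esub> P = Y" "Q \<cdot>\<^bsub>Js\<^esub> Y = Y" "B \<cdot>\<^bsub>Js\<^esub> Q = B"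
    using x y by (auto simp: P_def Q_def R_def S_def einstein_assoc)
  have idem: "R \<cdot>\<^bsub>Is\<^esub> R = R" "Q \<cdot>\<^bsub>Js\<^esub> Q = Q"
    using abs by (metis R_def einstein_assoc, metis Q_def einstein_assoc)
  \<comment> \<open>The absorption rules with a trailing factor, in the form needed to rewrite
    products nested to the right.\<close>
  have ext: "R \<cdot>\<^bsub>Is\<^esub> (A \<cdot>\<^bsub>K\<^esub> Z) = A \<cdot>\<^bsub>K\<^esub> Z" "X \<cdot>\<^bsub>Is\<^esub> (R \<cdot>\<^bsub>Is\<^esub> Z) = X \<cdot>\<^bsub>Is\<^esub> Z"
    "Y \<cdot>\<^bsub>Is\<^esub> (P \<cdot>\<^bsub>Is\<^esub> Z) = Y \<cdot>\<^bsub>Is\<^esub> Z"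
    "Q \<cdot>\<^bsub>Js\<^esub> (Y \<cdot>\<^bsub>K\<^esub> Z) = Y \<cdot>\<^bsub>K\<^esub> Z" "Q \<cdot>\<^bsub>Js\<^esub> (Q \<cdot>\<^bsub>Js\<^esub> Z) = Q \<cdot>\<^bsub>Js\<^esub> Z" for K Z
    using abs idem by (metis einstein_assoc)+
  \<comment> \<open>The signs are chosen so that \<open>Y - X = F2 - F1 + F3\<close>;
    \<open>W1\<close>, \<open>W2\<close> and \<open>W3\<close> are the blocks of
    \<open>B - A\<close> that control the three parts.\<close>
  define F1 where "F1 = Q \<cdot>\<^bsub>Js\<^esub> X - Y \<cdot>\<^bsub>Is\<^esub> R"
  define F2 where "F2 = Y - Y \<cdot>\<^bsub>Is\<^esub> R"
  define F3 where "F3 = Q \<cdot>\<^bsub>Js\<^esub> X - X"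
  define W1 where "W1 = P \<cdot>\<^bsub>Is\<^esub> (?E \<cdot>\<^bsub>Js\<^esub> S)"
  define W2 where "W2 = ?E \<cdot>\<^bsub>Js\<^esub> Q - R \<cdot>\<^bsub>Is\<^esub> (?E \<cdot>\<^bsub>Js\<^esub> Q)"
  define W3 where "W3 = R \<cdot>\<^bsub>Is\<^esub> ?E - (R \<cdot>\<^bsub>Is\<^esub> ?E) \<cdot>\<^bsub>Js\<^esub> Q"
  note expand = einstein_diff_left einstein_diff_right einstein_assoc
  have YB: "Y \<cdot>\<^bsub>Is\<^esub> (B \<cdot>\<^bsub>K\<^esub> Z) = Q \<cdot>\<^bsub>K\<^esub> Z" "X \<cdot>\<^bsub>Is\<^esub> (A \<cdot>\<^bsub>K\<^esub> Z) = S \<cdot>\<^bsub>K\<^esub> Z" for K Z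
    by (simp_all add: Q_def S_def einstein_assoc)
  \<comment> \<open>\<open>Y\<close> absorbs \<open>P\<close> and \<open>X\<close> absorbs
    \<open>S\<close>, which leaves \<open>Y (B - A) X = Q X - Y R\<close>.\<close>
  have F1: "F1 = Y \<cdot>\<^bsub>Is\<^esub> (W1 \<cdot>\<^bsub>Js\<^esub> X)"
    by (simp add: F1_def W1_def expand abs ext YB flip: R_def)
  \<comment> \<open>Only the \<open>B\<close> part of the perturbation survives, as
    \<open>R A = A\<close> makes \<open>1 - R\<close> annihilate \<open>A\<close>.\<close>
  have W2Y: "W2 \<cdot>\<^bsub>Js\<^esub> Y = P - R \<cdot>\<^bsub>Is\<^esub> P"
    by (simp add: W2_def expand abs ext flip: P_def)
  have F2: "F2 = Y \<cdot>\<^bsub>Is\<^esub> conj_transpose (W2 \<cdot>\<^bsub>Js\<^esub> Y)"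
    by (simp add: F2_def W2Y conj_transpose_diff conj_transpose_einstein herm expand abs ext)
  \<comment> \<open>Here the \<open>B\<close> part drops out, because
    \<open>B Q = B\<close>.\<close>
  have XW3: "X \<cdot>\<^bsub>Is\<^esub> W3 = S \<cdot>\<^bsub>Js\<^esub> Q - S"
    using abs by (simp add: W3_def expand ext YB flip: S_def)
  have F3: "F3 = conj_transpose (X \<cdot>\<^bsub>Is\<^esub> W3) \<cdot>\<^bsub>Js\<^esub> X"
    by (simp add: F3_def XW3 conj_transpose_diff conj_transpose_einstein herm expand abs)
  have X: "X \<in> tensors Js Is" and Y: "Y \<in> tensors Js Is" using x y by auto
  note left = frobenius_norm_mult_spectral(2) and right = frobenius_norm_mult_spectral_right
  have a: "0 \<le> ?a" and b: "0 \<le> ?b"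
    using frobenius_norm_mult_spectral(1) X Y pos by auto
  have scale: "t\<^sup>2 \<le> c\<^sup>2 * w\<^sup>2" if "t \<le> k * w" "k \<le> c" "0 \<le> t" "0 \<le> w" for t w k :: real
  proof -
    have "t \<le> c * w" using that by (meson mult_right_mono order_trans)
    then show ?thesis using that(3) by (metis power_mono power_mult_distrib)
  qed
  \<comment> \<open>The outer factors are \<open>Y\<close> and \<open>X\<close> for
    \<open>F1\<close>, \<open>Y\<close> twice for \<open>F2\<close> and \<open>X\<close> twice for
    \<open>F3\<close>: one entry of the maximum each.\<close>
  have "frobenius_norm Js Is F1 \<le> ?b * (frobenius_norm Is Js W1 * ?a)"
    unfolding F1 by (rule order_trans[OF left[OF Y pos] mult_left_mono[OF right[OF X pos] b]])
  then have n1: "(frobenius_norm Js Is F1)\<^sup>2 \<le> c\<^sup>2 * (frobenius_norm Is Js W1)\<^sup>2"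
    by (intro scale[OF _ c(1)]) (simp_all add: mult_ac)
  have "frobenius_norm Js Is F2 \<le> ?b * frobenius_norm Is Is (W2 \<cdot>\<^bsub>Js\<^esub> Y)"
    unfolding F2 using left[OF Y pos, of Is "conj_transpose (W2 \<cdot>\<^bsub>Js\<^esub> Y)"] by simp
  also have "\<dots> \<le> ?b * (frobenius_norm Is Js W2 * ?b)"
    by (rule mult_left_mono[OF right[OF Y pos] b])
  finally have n2: "(frobenius_norm Js Is F2)\<^sup>2 \<le> c\<^sup>2 * (frobenius_norm Is Js W2)\<^sup>2"
    by (intro scale[OF _ c(3)]) (simp_all add: mult_ac power2_eq_square)
  have "frobenius_norm Js Is F3 \<le> frobenius_norm Js Js (X \<cdot>\<^bsub>Is\<^esub> W3) * ?a"
    unfolding F3 using right[OF X pos, of Js "conj_transpose (X \<cdot>\<^bsub>Is\<^esub> W3)"] by simp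
  also have "\<dots> \<le> (?a * frobenius_norm Is Js W3) * ?a"
    by (rule mult_right_mono[OF left[OF X pos] a])
  finally have n3: "(frobenius_norm Js Is F3)\<^sup>2 \<le> c\<^sup>2 * (frobenius_norm Is Js W3)\<^sup>2"
    by (intro scale[OF _ c(2)]) (simp_all add: mult_ac power2_eq_square)
  \<comment> \<open>Right multiplication by \<open>R\<close> fixes \<open>F1\<close> and annihilates
    \<open>F2\<close>, so they are orthogonal; below, left multiplication by \<open>Q\<close>
    separates both from \<open>F3\<close> in the same way.\<close>
  have "F1 = F1 \<cdot>\<^bsub>Is\<^esub> R" "F2 \<cdot>\<^bsub>Is\<^esub> R = 0"
    by (simp_all add: F1_def F2_def expand abs idem)
  then have "frob_inner Js Is F1 F2 = 0"
    using frob_inner_adjoint_right[of Js Is Is F1 R F2] by (simp add: herm)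
  then have o12: "frob_inner Js Is F2 F1 = 0" using frob_inner_commute[of Js Is F2 F1] by simp
  have "F2 - F1 = Q \<cdot>\<^bsub>Js\<^esub> (F2 - F1)" "Q \<cdot>\<^bsub>Js\<^esub> (- F3) = 0"
    by (simp_all add: F1_def F2_def F3_def expand abs ext einstein_uminus)
  then have o3: "frob_inner Js Is (F2 - F1) (- F3) = 0"
    using frob_inner_adjoint_left[of Js Is Js Q "F2 - F1" "- F3"] by (simp add: herm)
  have "Y - X = (F2 - F1) - (- F3)" by (simp add: F1_def F2_def F3_def)
  then have "(frobenius_norm Js Is (Y - X))\<^sup>2
      = (frobenius_norm Js Is F2)\<^sup>2 + (frobenius_norm Js Is F1)\<^sup>2 + (frobenius_norm Js Is F3)\<^sup>2"
    by (simp only: frobenius_norm_diff_orthogonal[OF o3] frobenius_norm_diff_orthogonal[OF o12]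
        frobenius_norm_uminus)
  also have "\<dots> \<le> c\<^sup>2 * ((frobenius_norm Is Js W2)\<^sup>2 + (frobenius_norm Is Js W1)\<^sup>2 + (frobenius_norm Is Js W3)\<^sup>2)"
    unfolding distrib_left using n1 n2 n3 by (intro add_mono)
  also have "\<dots> \<le> c\<^sup>2 * ((frobenius_norm Is Js ?E)\<^sup>2 + (frobenius_norm Is Js W1)\<^sup>2
      - (frobenius_norm Is Js (R \<cdot>\<^bsub>Is\<^esub> (?E \<cdot>\<^bsub>Js\<^esub> Q)))\<^sup>2)"
  proof (rule mult_left_mono)
    have w2: "(frobenius_norm Is Js W2)\<^sup>2 = (frobenius_norm Is Js (?E \<cdot>\<^bsub>Js\<^esub> Q))\<^sup>2
        - (frobenius_norm Is Js (R \<cdot>\<^bsub>Is\<^esub> (?E \<cdot>\<^bsub>Js\<^esub> Q)))\<^sup>2"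
      unfolding W2_def by (rule frobenius_norm_projection_left[OF herm(3) idem(1)])
    \<comment> \<open>Dropping the projection \<open>R\<close> bounds \<open>W3\<close> by
      \<open>E - E Q\<close>, where \<open>E\<close> is \<open>B - A\<close>; the squared norm of
      \<open>E Q\<close> then cancels against the one in \<open>w2\<close>.\<close>
    have "W3 = R \<cdot>\<^bsub>Is\<^esub> (?E - ?E \<cdot>\<^bsub>Js\<^esub> Q)"
      by (simp add: W3_def expand)
    then have "(frobenius_norm Is Js W3)\<^sup>2 \<le> (frobenius_norm Is Js (?E - ?E \<cdot>\<^bsub>Js\<^esub> Q))\<^sup>2"
      using frobenius_norm_projection_left[OF herm(3) idem(1), of Js "?E - ?E \<cdot>\<^bsub>Js\<^esub> Q"]
      by (metis diff_ge_0_iff_ge zero_le_power2)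
    also have "\<dots> = (frobenius_norm Is Js ?E)\<^sup>2 - (frobenius_norm Is Js (?E \<cdot>\<^bsub>Js\<^esub> Q))\<^sup>2"
      by (rule frobenius_norm_projection_right[OF herm(2) idem(2)])
    finally show "(frobenius_norm Is Js W2)\<^sup>2 + (frobenius_norm Is Js W1)\<^sup>2 + (frobenius_norm Is Js W3)\<^sup>2
      \<le> (frobenius_norm Is Js ?E)\<^sup>2 + (frobenius_norm Is Js W1)\<^sup>2
        - (frobenius_norm Is Js (R \<cdot>\<^bsub>Is\<^esub> (?E \<cdot>\<^bsub>Js\<^esub> Q)))\<^sup>2"
      using w2 by simp
  qed simp
  finally show ?thesis unfolding W1_def P_def Q_def R_def S_def .
qed

theorem theorem3p9:
  fixes N r s :: nat and Is Js :: "nat list" and A B E :: tensor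
  assumes "1 \<le> N" and "length Is = N" and "length Js = N"
    and "\<forall>d\<in>set Is. 1 \<le> d" and "\<forall>d\<in>set Js. 1 \<le> d"
    and "A \<in> tensors Is Js" and "E \<in> tensors Is Js"
    and "B = A + E"
    and "unfolding_rank Is Js A = r" and "unfolding_rank Is Js B = s"
  shows "frobenius_norm Js Is (MP_inverse Is Js B - MP_inverse Is Js A)
    \<le> Max {spectral_norm Js Is (MP_inverse Is Js A) * spectral_norm Js Is (MP_inverse Is Js B),
            (spectral_norm Js Is (MP_inverse Is Js A))\<^sup>2,
            (spectral_norm Js Is (MP_inverse Is Js B))\<^sup>2}
      * frobenius_norm Is Js E"
proof -
  let ?X = "MP_inverse Is Js A" and ?Y = "MP_inverse Is Js B"
  let ?a = "spectral_norm Js Is ?X" and ?b = "spectral_norm Js Is ?Y"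
  define c where "c = Max {?a * ?b, ?a\<^sup>2, ?b\<^sup>2}"
  have c: "?a * ?b \<le> c" "?a\<^sup>2 \<le> c" "?b\<^sup>2 \<le> c" by (simp_all add: c_def)
  then have c': "?b * ?a \<le> c" by (simp add: mult.commute)
  have c0: "0 \<le> c" using c(2) by (meson order_trans zero_le_power2)
  have A: "A \<in> tensors Is Js" by fact
  have B: "B \<in> tensors Is Js" using assms(6-8) by (auto simp: tensors_def)
  have E: "B - A = E" "A - B = - E" using assms(8) by auto
  \<comment> \<open>The inverses have column format \<open>Is\<close>, so this ensures that they
    have singular values.\<close>
  have pos: "0 < prod_list Is" using assms(4) by (induction Is) auto
  let ?u = "(frobenius_norm Is Js ((B \<cdot>\<^bsub>Js\<^esub> ?Y) \<cdot>\<^bsub>Is\<^esub> (E \<cdot>\<^bsub>Js\<^esub> (?X \<cdot>\<^bsub>Is\<^esub> A))))\<^sup>2"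
    and ?v = "(frobenius_norm Is Js ((A \<cdot>\<^bsub>Js\<^esub> ?X) \<cdot>\<^bsub>Is\<^esub> (E \<cdot>\<^bsub>Js\<^esub> (?Y \<cdot>\<^bsub>Is\<^esub> B))))\<^sup>2"
  have "(frobenius_norm Js Is (?Y - ?X))\<^sup>2 \<le> c\<^sup>2 * ((frobenius_norm Is Js E)\<^sup>2 + ?u - ?v)"
    using wedin_bound[OF A B pos MP_inverse[OF A] MP_inverse[OF B] c] unfolding E .
  \<comment> \<open>With the roles exchanged the perturbation is \<open>- E\<close>; its sign
    disappears under the norms, so \<open>?u\<close> and \<open>?v\<close> merely swap.\<close>
  moreover have "(frobenius_norm Js Is (?X - ?Y))\<^sup>2 \<le> c\<^sup>2 * ((frobenius_norm Is Js E)\<^sup>2 + ?v - ?u)"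
    using wedin_bound[OF B A pos MP_inverse[OF B] MP_inverse[OF A] c' c(3,2)]
    unfolding E einstein_uminus frobenius_norm_uminus .
  moreover have "frobenius_norm Js Is (?X - ?Y) = frobenius_norm Js Is (?Y - ?X)"
    using frobenius_norm_uminus[of Js Is "?Y - ?X"] by simp
  \<comment> \<open>Adding the two bounds cancels \<open>?u\<close> and \<open>?v\<close> and leaves
    twice the desired inequality.\<close>
  ultimately have "(frobenius_norm Js Is (?Y - ?X))\<^sup>2 \<le> (c * frobenius_norm Is Js E)\<^sup>2"
    by (simp add: power_mult_distrib algebra_simps)
  then have "frobenius_norm Js Is (?Y - ?X) \<le> c * frobenius_norm Is Js E"
    by (rule power2_le_imp_le) (simp add: c0)
  then show ?thesis unfolding c_def .
qed

end
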